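(* Let $\bar w\sim\mathcal{N}(0,\bar\Sigma)$ with $\bar\Sigma>0$, let $\eta(\bar x_\theta,\bar u_\theta)=T^x\bar x_\theta+T^u\bar u_\theta-y$ with $T^x\in\mathbb{R}^{r\times(N+1)n}$, $T^u\in\mathbb{R}^{r\times Nm}$, $y\in\mathbb{R}^r$, and for $t_i>0$, $i=1,\dots,r$, let $\varphi(\eta)=\sum_{i=1}^r\exp(t_i\eta_i)$ for $\eta\in\mathbb{R}^r$. Then, for $\theta\in\Theta$, $$\mathbb{E}\big[\varphi\big(\eta(\bar x_\theta,\bar u_\theta)\big)\big]=\sum_{i=1}^r\exp\Big(t_ih_{i,\theta}+\frac{t_i^2}{2}\|\bar\Sigma^{1/2}P_{i,\theta}\|^2\Big).$$ As a consequence, if $V:\mathbb{R}^{(N+1)n}\times\mathbb{R}^{Nm}\to\mathbb{R}$ is measurable and convex and $\mathbb{E}[V(\bar x_\theta,\bar u_\theta)]$ is finite for all $\theta\in\Theta$, then for any $\alpha\in\,]0,1[$ and any choice of $t_i>0$, $i=1,\dots,r$, the problem $$\inf_{\theta\in\Theta}\ \mathbb{E}[V(\bar x_\theta,\bar u_\theta)]\quad\text{subject to}\quad\sum_{i=1}^r\exp\Big(t_ih_{i,\theta}+\frac{t_i^2}{2}\|\bar\Sigma^{1/2}P_{i,\theta}\|^2\Big)\le\alpha$$ is a convex conservative approximation of the problem $$\inf_{\theta\in\Theta}\ \mathbb{E}[V(\bar x_\theta,\bar u_\theta)]\quad\text{subject to}\quad\mathbb{P}(\eta(\bar x_\theta,\bar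 u_\theta)\le 0)\ge 1-\alpha.$$
   Context: Let $n,m,N,r\ge 1$ be integers, $A\in\mathbb{R}^{n\times n}$, $B\in\mathbb{R}^{n\times m}$, $x_0\in\mathbb{R}^n$, and let $w(0),\dots,w(N-1)$ be $\mathbb{R}^n$-valued random vectors on a probability space $(\Omega,\mathfrak{F},\mathbb{P})$, stacked into $\bar w\in\mathbb{R}^{Nn}$. The linear system $x(t+1)=Ax(t)+Bu(t)+w(t)$, $x(0)=x_0$, is written over $t=0,\dots,N$ as $\bar x=\bar A x_0+\bar B\bar u+\bar D\bar w$, where $\bar x\in\mathbb{R}^{(N+1)n}$ stacks $x(0),\dots,x(N)$ and $\bar u\in\mathbb{R}^{Nm}$ stacks $u(0),\dots,u(N-1)$; $\bar A$ stacks $I_n,A,\dots,A^N$; $\bar B$ is the $(N+1)n\times Nm$ matrix whose $n\times m$ block in position $(t,s)$, $0\le t\le N$, $0\le s\le N-1$, is $A^{t-1-s}B$ if $s<t$ and $0$ otherwise; $\bar D$ is the $(N+1)n\times Nn$ matrix whose $n\times n$ block $(t,s)$ is $A^{t-1-s}$ if $s<t$ and $0$ otherwise. $\Theta$ is the linear space of parameters $\theta=(\bar G,\bar d)$ with $\bar d\in\mathbb{R}^{Nm}$ and $\bar G\in\mathbb{R}^{Nm\times Nn}$ strictly block lower triangular (its $m\times n$ block $(t,i)$, $0\le t,i\le N-1$, vanishes whenever $i\ge t$). For $\theta\in\Theta$, $\bar u_\theta=\bar G\bar w+\bar d$ and $\bar x_\theta=\bar A x_0+\bar B(\bar G\bar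 w+\bar d)+\bar D\bar w$. Set $h_\theta=(T^x\bar A x_0-y)+(T^x\bar B+T^u)\bar d\in\mathbb{R}^r$ and $P_\theta=T^x\bar D+(T^x\bar B+T^u)\bar G\in\mathbb{R}^{r\times Nn}$, so that $\eta(\bar x_\theta,\bar u_\theta)=h_\theta+P_\theta\bar w$; $h_{i,\theta}$ is the $i$-th entry of $h_\theta$ and $P_{i,\theta}^T$ the $i$-th row of $P_\theta$. $\bar\Sigma^{1/2}$ is a symmetric real square root of $\bar\Sigma$, $\|\cdot\|$ is the Euclidean norm, vector inequalities are componentwise. A problem is a convex conservative approximation of another problem with the same objective if its objective is convex, its feasible set is convex, and every $\theta$ feasible for it is feasible for the other problem. *)

theory Defs
  imports "HOL-Probability.Probability"
begin

section \<open>Time indices and stacked vectors\<close>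

text \<open>
  The horizon \<open>N\<close> is \<open>CARD('k)\<close> for a finite linearly ordered type \<open>'k\<close>, whose elements
  stand for the times \<open>0, \<dots>, N - 1\<close> (of inputs and disturbances) through their rank \<open>stage\<close>.
  The times \<open>0, \<dots>, N\<close> of the states are indexed by \<open>'k option\<close>.
  A stacked vector has components indexed by pairs (time, component), so that for instance
  \<open>real ^ ('k option \<times> 'n)\<close> is the Euclidean space of dimension \<open>(N + 1) n\<close>.
\<close>

definition stage :: "'k::{finite,linorder} \<Rightarrow> nat" where
  "stage t = card {..<t}"

definition state_stage :: "'k::{finite,linorder} option \<Rightarrow> nat" where
  "state_stage t = (case t of None \<Rightarrow> 0 | Some s \<Rightarrow> Suc (stage s))"

definition stack_inputs :: "(nat \<Rightarrow> real ^ 'm) \<Rightarrow> real ^ ('k::{finite,linorder} \<times> 'm)" where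
  "stack_inputs v = (\<chi> p. v (stage (fst p)) $ snd p)"

definition stack_states :: "(nat \<Rightarrow> real ^ 'n) \<Rightarrow> real ^ ('k::{finite,linorder} option \<times> 'n)" where
  "stack_states v = (\<chi> p. v (state_stage (fst p)) $ snd p)"

lemma strict_mono_stage: "s < t \<Longrightarrow> stage s < stage t"
  unfolding stage_def by (rule psubset_card_mono) auto

lemma inj_stage: "inj stage"
  by (rule injI) (metis less_irrefl linorder_neqE strict_mono_stage)

lemma bij_betw_stage: "bij_betw (stage :: 'k::{finite,linorder} \<Rightarrow> nat) UNIV {..<CARD('k)}"
proof -
  have "stage t < CARD('k)" for t :: 'k
    unfolding stage_def by (rule psubset_card_mono) auto
  then have "range (stage :: 'k \<Rightarrow> nat) \<subseteq> {..<CARD('k)}" by auto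
  moreover have "card (range (stage :: 'k \<Rightarrow> nat)) = card {..<CARD('k)}"
    by (simp add: card_image inj_stage)
  ultimately have "range (stage :: 'k \<Rightarrow> nat) = {..<CARD('k)}"
    by (intro card_subset_eq) auto
  then show ?thesis
    by (simp add: bij_betw_def inj_stage)
qed

lemma bij_betw_state_stage:
  "bij_betw (state_stage :: 'k::{finite,linorder} option \<Rightarrow> nat) UNIV {..CARD('k)}"
proof -
  have r: "range (stage :: 'k \<Rightarrow> nat) = {..<CARD('k)}"
    using bij_betw_stage by (rule bij_betw_imp_surj_on)
  have "inj (state_stage :: 'k option \<Rightarrow> nat)"
    by (auto intro!: injI simp: state_stage_def inj_eq[OF inj_stage] split: option.splits)
  moreover have "range (state_stage :: 'k option \<Rightarrow> nat) = insert 0 (Suc ` range (stage :: 'k \<Rightarrow> nat))"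
    by (auto simp: UNIV_option_conv state_stage_def image_image)
  ultimately show ?thesis
    unfolding r by (simp add: bij_betw_def lessThan_Suc_eq_insert_0[symmetric] lessThan_Suc_atMost)
qed

section \<open>The stacked linear system\<close>

text \<open>On matrices \<open>real ^ 'n ^ 'n\<close> the library's \<open>(*)\<close>, and hence \<open>(^)\<close>, is componentwise.\<close>

primrec mat_pow :: "real ^ 'n ^ 'n \<Rightarrow> nat \<Rightarrow> real ^ 'n ^ 'n" where
  "mat_pow A 0 = mat 1"
| "mat_pow A (Suc j) = A ** mat_pow A j"

definition Abar :: "real ^ 'n ^ 'n \<Rightarrow> real ^ 'n ^ ('k::{finite,linorder} option \<times> 'n)" where
  "Abar A = (\<chi> p b. mat_pow A (state_stage (fst p)) $ snd p $ b)"

definition Bbar ::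
  "real ^ 'n ^ 'n \<Rightarrow> real ^ 'm ^ 'n \<Rightarrow> real ^ ('k::{finite,linorder} \<times> 'm) ^ ('k option \<times> 'n)" where
  "Bbar A B = (\<chi> p q.
     if stage (fst q) < state_stage (fst p)
     then (mat_pow A (state_stage (fst p) - 1 - stage (fst q)) ** B) $ snd p $ snd q
     else 0)"

definition Dbar ::
  "real ^ 'n ^ 'n \<Rightarrow> real ^ ('k::{finite,linorder} \<times> 'n) ^ ('k option \<times> 'n)" where
  "Dbar A = (\<chi> p q.
     if stage (fst q) < state_stage (fst p)
     then mat_pow A (state_stage (fst p) - 1 - stage (fst q)) $ snd p $ snd q
     else 0)"

primrec trajectory ::
  "real ^ 'n ^ 'n \<Rightarrow> real ^ 'm ^ 'n \<Rightarrow> real ^ 'n \<Rightarrow> (nat \<Rightarrow> real ^ 'm) \<Rightarrow> (nat \<Rightarrow> real ^ 'n) \<Rightarrow>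
   nat \<Rightarrow> real ^ 'n" where
  "trajectory A B x0 u w 0 = x0"
| "trajectory A B x0 u w (Suc t) = A *v trajectory A B x0 u w t + B *v u t + w t"

lemma trajectory_eq:
  "trajectory A B x0 u w t =
     mat_pow A t *v x0 + (\<Sum>s<t. mat_pow A (t - 1 - s) *v (B *v u s + w s))"
proof (induction t)
  case (Suc t)
  have "A *v (\<Sum>s<t. mat_pow A (t - 1 - s) *v (B *v u s + w s)) =
        (\<Sum>s<t. mat_pow A (t - s) *v (B *v u s + w s))"
    unfolding linear_sum[OF matrix_vector_mul_linear]
  proof (rule sum.cong)
    fix s assume "s \<in> {..<t}"
    then have "t - s = Suc (t - 1 - s)" by auto
    then show "A *v (mat_pow A (t - 1 - s) *v (B *v u s + w s)) =
               mat_pow A (t - s) *v (B *v u s + w s)"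
      by (simp add: matrix_vector_mul_assoc)
  qed simp
  with Suc show ?case
    by (simp add: matrix_vector_right_distrib matrix_vector_mul_assoc algebra_simps)
qed simp

lemma sum_blocks:
  fixes f :: "nat \<Rightarrow> real"
  assumes "t \<le> CARD('k::{finite,linorder})"
  shows "(\<Sum>s\<in>(UNIV :: 'k set). if stage s < t then f (stage s) else 0) = (\<Sum>j<t. f j)"
proof -
  have "(\<Sum>s\<in>(UNIV :: 'k set). if stage s < t then f (stage s) else 0) =
        (\<Sum>j<CARD('k). if j < t then f j else 0)"
    by (rule sum.reindex_bij_betw[OF bij_betw_stage])
  also have "\<dots> = (\<Sum>j<t. f j)"
    using assms by (intro sum.mono_neutral_cong_right) auto
  finally show ?thesis .
qed

lemma sum_pairs:
  fixes f :: "'k::finite \<times> 'm::finite \<Rightarrow> real"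
  shows "(\<Sum>q\<in>UNIV. f q) = (\<Sum>s\<in>UNIV. \<Sum>b\<in>UNIV. f (s, b))"
  by (simp add: sum.cartesian_product)

lemma stack_states_trajectory:
  fixes A :: "real ^ 'n ^ 'n" and B :: "real ^ 'm ^ 'n"
  shows "(stack_states (trajectory A B x0 u w) :: real ^ ('k::{finite,linorder} option \<times> 'n)) =
     Abar A *v x0 + Bbar A B *v stack_inputs u + Dbar A *v stack_inputs w"
proof -
  have "stack_states (trajectory A B x0 u w) $ (t, a) =
     (Abar A *v x0 + Bbar A B *v stack_inputs u + Dbar A *v stack_inputs w) $ (t, a)"
    for t :: "'k option" and a :: 'n
  proof -
    let ?t = "state_stage t"
    have le: "?t \<le> CARD('k)"
      using bij_betw_state_stage[where 'k='k] unfolding bij_betw_def by auto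
    have B: "(Bbar A B *v (stack_inputs u :: real ^ ('k \<times> 'm))) $ (t, a) =
        (\<Sum>s<?t. (mat_pow A (?t - 1 - s) *v (B *v u s)) $ a)"
      unfolding sum_blocks[OF le, symmetric] matrix_vector_mul_assoc
      by (simp add: Bbar_def stack_inputs_def matrix_vector_mult_def sum_pairs)
        (auto intro!: sum.cong simp: matrix_vector_mult_def)
    have D: "(Dbar A *v (stack_inputs w :: real ^ ('k \<times> 'n))) $ (t, a) =
        (\<Sum>s<?t. (mat_pow A (?t - 1 - s) *v w s) $ a)"
      unfolding sum_blocks[OF le, symmetric]
      by (simp add: Dbar_def stack_inputs_def matrix_vector_mult_def sum_pairs)
        (auto intro!: sum.cong simp: matrix_vector_mult_def)
    have A: "(Abar A *v x0) $ (t, a) = (mat_pow A ?t *v x0) $ a"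
      by (simp add: Abar_def matrix_vector_mult_def)
    show ?thesis
      unfolding vector_add_component A B D
      by (simp add: stack_states_def trajectory_eq matrix_vector_right_distrib sum.distrib)
  qed
  then show ?thesis
    by (simp add: vec_eq_iff)
qed

section \<open>Affine disturbance feedback\<close>

type_synonym ('k, 'm, 'n) policy = "(real ^ ('k \<times> 'n) ^ ('k \<times> 'm)) \<times> (real ^ ('k \<times> 'm))"

definition Theta :: "('k::{finite,linorder}, 'm::finite, 'n::finite) policy set" where
  "Theta = {(G, d). \<forall>t i a b. t \<le> i \<longrightarrow> G $ (t, a) $ (i, b) = 0}"

definition ubar ::
  "('k::{finite,linorder}, 'm::finite, 'n::finite) policy \<Rightarrow> real ^ ('k \<times> 'n) \<Rightarrow> real ^ ('k \<times> 'm)"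
  where "ubar \<theta> wb = fst \<theta> *v wb + snd \<theta>"

definition xbar ::
  "real ^ 'n ^ 'n \<Rightarrow> real ^ 'm ^ 'n \<Rightarrow> real ^ 'n \<Rightarrow> ('k::{finite,linorder}, 'm, 'n) policy \<Rightarrow>
   real ^ ('k \<times> 'n) \<Rightarrow> real ^ ('k option \<times> 'n)"
  where "xbar A B x0 \<theta> wb = Abar A *v x0 + Bbar A B *v (fst \<theta> *v wb + snd \<theta>) + Dbar A *v wb"

definition eta ::
  "real ^ ('k option \<times> 'n::finite) ^ 'r \<Rightarrow> real ^ ('k \<times> 'm::finite) ^ 'r \<Rightarrow> real ^ 'r \<Rightarrow>
   real ^ ('k::{finite,linorder} option \<times> 'n) \<Rightarrow> real ^ ('k \<times> 'm) \<Rightarrow> real ^ 'r"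
  where "eta Tx Tu y x u = Tx *v x + Tu *v u - y"

definition h_of ::
  "real ^ 'n ^ 'n \<Rightarrow> real ^ 'm ^ 'n \<Rightarrow> real ^ 'n \<Rightarrow>
   real ^ ('k option \<times> 'n) ^ 'r \<Rightarrow> real ^ ('k \<times> 'm) ^ 'r \<Rightarrow> real ^ 'r \<Rightarrow>
   ('k::{finite,linorder}, 'm, 'n) policy \<Rightarrow> real ^ 'r"
  where "h_of A B x0 Tx Tu y \<theta> = (Tx *v (Abar A *v x0) - y) + (Tx ** Bbar A B + Tu) *v snd \<theta>"

definition P_of ::
  "real ^ 'n ^ 'n \<Rightarrow> real ^ 'm ^ 'n \<Rightarrow>
   real ^ ('k option \<times> 'n) ^ 'r \<Rightarrow> real ^ ('k \<times> 'm) ^ 'r \<Rightarrow>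
   ('k::{finite,linorder}, 'm, 'n) policy \<Rightarrow> real ^ ('k \<times> 'n) ^ 'r"
  where "P_of A B Tx Tu \<theta> = Tx ** Dbar A + (Tx ** Bbar A B + Tu) ** fst \<theta>"

definition exp_sum :: "real ^ 'r \<Rightarrow> real ^ 'r \<Rightarrow> real" where
  "exp_sum t \<eta> = (\<Sum>i\<in>UNIV. exp (t $ i * \<eta> $ i))"

section \<open>Nondegenerate Gaussian random vectors\<close>

definition positive_definite :: "real ^ 'd ^ 'd \<Rightarrow> bool" where
  "positive_definite S \<longleftrightarrow> transpose S = S \<and> (\<forall>x. x \<noteq> 0 \<longrightarrow> 0 < x \<bullet> (S *v x))"

definition mvn_density :: "real ^ 'd \<Rightarrow> real ^ 'd ^ 'd \<Rightarrow> real ^ 'd \<Rightarrow> real" where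
  "mvn_density \<mu> S x =
     exp (- ((x - \<mu>) \<bullet> (matrix_inv S *v (x - \<mu>))) / 2) / sqrt ((2 * pi) ^ CARD('d) * det S)"

text \<open>Meaningful only for positive definite covariance \<open>S\<close>.\<close>

definition mvn_distributed ::
  "'a measure \<Rightarrow> ('a \<Rightarrow> real ^ 'd) \<Rightarrow> real ^ 'd \<Rightarrow> real ^ 'd ^ 'd \<Rightarrow> bool" where
  "mvn_distributed M X \<mu> S \<longleftrightarrow> distributed M lborel X (\<lambda>x. ennreal (mvn_density \<mu> S x))"

section \<open>Optimization problems\<close>

record 'b opt_problem =
  decision_space :: "'b set"
  objective :: "'b \<Rightarrow> real"
  constr :: "'b \<Rightarrow> bool"

definition feasible :: "'b opt_problem \<Rightarrow> 'b set" where
  "feasible p = {\<theta> \<in> decision_space p. constr p \<theta>}"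

text \<open>Objectives are compared, and required to be convex, on the decision space only.\<close>

definition convex_conservative_approx :: "'b::real_vector opt_problem \<Rightarrow> 'b opt_problem \<Rightarrow> bool" where
  "convex_conservative_approx p q \<longleftrightarrow>
     decision_space p = decision_space q \<and>
     (\<forall>\<theta>\<in>decision_space p. objective p \<theta> = objective q \<theta>) \<and>
     convex_on (decision_space p) (objective p) \<and>
     convex (feasible p) \<and>
     feasible p \<subseteq> feasible q"

end

theory Submission
  imports Defs
begin

text \<open>
  Everything rests on the exponential moments of a Gaussian vector and on the fact that both
  problems see the policy only through the affine map that sends \<open>\<theta>\<close> to the state and input
  trajectories.

  Multiplying the density of \<open>\<N>(\<mu>, S)\<close> by \<open>exp (v \<bullet> x)\<close> and completing the square gives a
  constant times the density of \<open>\<N>(\<mu> + S v, S)\<close>, which is a translate of the original one and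
  hence has the same total mass, namely one. So \<open>E (exp (v \<bullet> X))\<close> is that constant,
  \<open>exp (v \<bullet> \<mu> + v \<bullet> S v / 2)\<close> (\<open>expectation_exp_mvn\<close>), read off from the normalisation of the density.
  Since \<open>\<eta>\<close> is affine in the disturbance (\<open>eta_closed_loop\<close>), summing over the constraints
  gives the closed formula.

  For a fixed disturbance, trajectories depend affinely on \<open>\<theta>\<close>, so a convex cost stays convex in
  \<open>\<theta>\<close>, and integration over the disturbance preserves convexity. This gives the convexity of the
  objective, and also that of the feasible set: by the closed formula the deterministic
  constraint function is itself the expectation of a convex cost, the sum of exponentials.

  Conservativeness is Markov's inequality in Chernoff's form: if some \<open>\<eta>\<^sub>i\<close> is positive, then
  the sum of exponentials exceeds one, so its expectation bounds the probability of violation.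
\<close>

section \<open>Exponential moments of a Gaussian vector\<close>

lemma invertible_positive_definite:
  fixes S :: "real ^ 'd ^ 'd"
  assumes "positive_definite S"
  shows "invertible S"
proof -
  have "x = 0" if "S *v x = 0" for x
    using assms that unfolding positive_definite_def by (metis inner_zero_right less_irrefl)
  then show ?thesis
    by (simp add: invertible_left_inverse matrix_left_invertible_ker)
qed

text \<open>Completing the square: tilting by \<open>exp (v \<bullet> x)\<close> translates the density by \<open>S v\<close>.\<close>

lemma exp_times_mvn_density:
  fixes S :: "real ^ 'd ^ 'd"
  assumes "positive_definite S"
  shows "exp (v \<bullet> x) * mvn_density \<mu> S x =
    exp (v \<bullet> \<mu> + v \<bullet> (S *v v) / 2) * mvn_density \<mu> S (x - S *v v)"
proof -
  define z where "z = x - \<mu>"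
  have inv: "S ** matrix_inv S = mat 1" "matrix_inv S ** S = mat 1"
    using someI_ex[OF invertible_positive_definite[OF assms, unfolded invertible_def]]
    unfolding matrix_inv_def by auto
  have sym: "(S *v a) \<bullet> b = a \<bullet> (S *v b)" for a b
    using assms unfolding positive_definite_def by (metis dot_lmul_matrix vector_transpose_matrix)
  have "(z - S *v v) \<bullet> (matrix_inv S *v (z - S *v v)) =
      z \<bullet> (matrix_inv S *v z) - 2 * (v \<bullet> z) + v \<bullet> (S *v v)"
    by (simp add: matrix_vector_mult_diff_distrib matrix_vector_mul_assoc inv inner_diff_left
        inner_diff_right sym) (simp add: inner_commute)
  moreover have "x - S *v v - \<mu> = z - S *v v" "v \<bullet> x = v \<bullet> z + v \<bullet> \<mu>"
    by (simp_all add: z_def inner_diff_right)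
  ultimately show ?thesis
    unfolding mvn_density_def z_def[symmetric]
    by (simp add: exp_add[symmetric] field_simps)
qed

text \<open>
  The total mass of the translated density is one because the original one is the density of a
  random vector and Lebesgue measure is translation invariant.
\<close>

lemma (in prob_space) expectation_exp_mvn:
  fixes X :: "'a \<Rightarrow> real ^ 'd"
  assumes S: "positive_definite S" and X: "mvn_distributed M X \<mu> S"
  shows "integrable M (\<lambda>\<omega>. exp (v \<bullet> X \<omega>))"
    and "expectation (\<lambda>\<omega>. exp (v \<bullet> X \<omega>)) = exp (v \<bullet> \<mu> + v \<bullet> (S *v v) / 2)"
proof -
  let ?f = "\<lambda>x. ennreal (mvn_density \<mu> S x)"
  let ?c = "exp (v \<bullet> \<mu> + v \<bullet> (S *v v) / 2)"
  have dist: "distributed M lborel X ?f"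
    using X by (simp add: mvn_distributed_def)
  have [measurable]: "X \<in> borel_measurable M"
    using distributed_measurable[OF dist] by simp
  have [measurable]: "?f \<in> borel_measurable borel"
    using distributed_borel_measurable[OF dist] by simp
  have mass: "(\<integral>\<^sup>+x. ?f x \<partial>lborel) = 1"
    using distributed_nn_integral[OF dist, of "\<lambda>_. 1"] by (simp add: emeasure_space_1)
  have "(\<integral>\<^sup>+\<omega>. ennreal (exp (v \<bullet> X \<omega>)) \<partial>M) = (\<integral>\<^sup>+x. ?f x * ennreal (exp (v \<bullet> x)) \<partial>lborel)"
    by (rule distributed_nn_integral[OF dist, symmetric]) simp
  also have "\<dots> = (\<integral>\<^sup>+x. ennreal ?c * ?f (x - S *v v) \<partial>lborel)"
    by (simp add: ennreal_mult'[symmetric] mult.commute[of "?f _"] exp_times_mvn_density[OF S])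
  also have "\<dots> = ennreal ?c * (\<integral>\<^sup>+x. ?f (x - S *v v) \<partial>lborel)"
    by (rule nn_integral_cmult) measurable
  also have "(\<integral>\<^sup>+x. ?f (x - S *v v) \<partial>lborel) = (\<integral>\<^sup>+x. ?f x \<partial>distr lborel borel ((+) (- (S *v v))))"
    by (simp add: nn_integral_distr)
  also have "\<dots> = 1"
    by (simp add: lborel_distr_plus mass)
  finally have "(\<integral>\<^sup>+\<omega>. ennreal (exp (v \<bullet> X \<omega>)) \<partial>M) = ennreal ?c" by simp
  then have "has_bochner_integral M (\<lambda>\<omega>. exp (v \<bullet> X \<omega>)) ?c"
    by (intro has_bochner_integral_nn_integral) auto
  then show "integrable M (\<lambda>\<omega>. exp (v \<bullet> X \<omega>))"
    and "expectation (\<lambda>\<omega>. exp (v \<bullet> X \<omega>)) = ?c"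
    by (auto simp: has_bochner_integral_iff)
qed

section \<open>Affine dependence on disturbance and policy\<close>

lemma eta_closed_loop:
  "eta Tx Tu y (xbar A B x0 \<theta> wb) (ubar \<theta> wb) =
     h_of A B x0 Tx Tu y \<theta> + P_of A B Tx Tu \<theta> *v wb"
  unfolding eta_def xbar_def ubar_def h_of_def P_of_def
  by (simp add: matrix_vector_right_distrib matrix_vector_mult_add_rdistrib
      matrix_vector_mul_assoc[symmetric] algebra_simps)

lemma convex_Theta: "convex Theta"
  unfolding Theta_def by (auto simp: convex_def)

lemma ubar_convex_combination:
  "ubar (a *\<^sub>R \<theta> + b *\<^sub>R \<theta>') wb = a *\<^sub>R ubar \<theta> wb + b *\<^sub>R ubar \<theta>' wb"
  by (simp add: ubar_def matrix_vector_mult_add_rdistrib scaleR_matrix_vector_assoc[symmetric]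
      algebra_simps)

lemma xbar_convex_combination:
  assumes "a + b = 1"
  shows "xbar A B x0 (a *\<^sub>R \<theta> + b *\<^sub>R \<theta>') wb = a *\<^sub>R xbar A B x0 \<theta> wb + b *\<^sub>R xbar A B x0 \<theta>' wb"
proof -
  have *: "xbar A B x0 \<theta> wb = (Abar A *v x0 + Dbar A *v wb) + Bbar A B *v ubar \<theta> wb" for \<theta>
    by (simp add: xbar_def ubar_def)
  have b: "b = 1 - a"
    using assms by simp
  show ?thesis
    unfolding * ubar_convex_combination b
    by (simp add: matrix_vector_right_distrib matrix_vector_mult_scaleR algebra_simps)
qed

section \<open>Convexity of expected costs\<close>

lemma convex_on_closed_loop_cost:
  assumes "convex_on UNIV V"
  shows "convex_on (Theta :: ('k::{finite,linorder}, 'm::finite, 'n::finite) policy set)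
    (\<lambda>\<theta>. V (xbar A B x0 \<theta> wb, ubar \<theta> wb))"
proof (intro convex_onI convex_Theta)
  fix s :: real and \<theta> \<theta>' :: "('k, 'm, 'n) policy"
  assume "0 < s" "s < 1"
  then show "V (xbar A B x0 ((1 - s) *\<^sub>R \<theta> + s *\<^sub>R \<theta>') wb, ubar ((1 - s) *\<^sub>R \<theta> + s *\<^sub>R \<theta>') wb)
      \<le> (1 - s) * V (xbar A B x0 \<theta> wb, ubar \<theta> wb) + s * V (xbar A B x0 \<theta>' wb, ubar \<theta>' wb)"
    using convex_onD[OF assms, of s "(xbar A B x0 \<theta> wb, ubar \<theta> wb)" "(xbar A B x0 \<theta>' wb, ubar \<theta>' wb)"]
    by (simp add: xbar_convex_combination ubar_convex_combination)
qed

lemma convex_on_integral: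
  fixes F :: "'b::real_vector \<Rightarrow> 'a \<Rightarrow> real"
  assumes "convex S"
    and int: "\<And>\<theta>. \<theta> \<in> S \<Longrightarrow> integrable M (F \<theta>)"
    and conv: "\<And>\<omega>. convex_on S (\<lambda>\<theta>. F \<theta> \<omega>)"
  shows "convex_on S (\<lambda>\<theta>. \<integral>\<omega>. F \<theta> \<omega> \<partial>M)"
proof (intro convex_onI \<open>convex S\<close>)
  fix s :: real and a b
  assume s: "0 < s" "s < 1" and ab: "a \<in> S" "b \<in> S"
  then have "(1 - s) *\<^sub>R a + s *\<^sub>R b \<in> S"
    using \<open>convex S\<close> by (simp add: convex_alt)
  then have "(\<integral>\<omega>. F ((1 - s) *\<^sub>R a + s *\<^sub>R b) \<omega> \<partial>M) \<le> (\<integral>\<omega>. (1 - s) * F a \<omega> + s * F b \<omega> \<partial>M)"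
    using s ab int convex_onD[OF conv] by (intro integral_mono) auto
  also have "\<dots> = (1 - s) * (\<integral>\<omega>. F a \<omega> \<partial>M) + s * (\<integral>\<omega>. F b \<omega> \<partial>M)"
    using int ab by simp
  finally show "(\<integral>\<omega>. F ((1 - s) *\<^sub>R a + s *\<^sub>R b) \<omega> \<partial>M) \<le>
      (1 - s) * (\<integral>\<omega>. F a \<omega> \<partial>M) + s * (\<integral>\<omega>. F b \<omega> \<partial>M)" .
qed

lemma convex_sublevel:
  assumes "convex_on S f"
  shows "convex {x \<in> S. f x \<le> a}"
proof (rule convexI)
  fix x y and u v :: real
  assume xy: "x \<in> {x \<in> S. f x \<le> a}" "y \<in> {x \<in> S. f x \<le> a}"
    and uv: "0 \<le> u" "0 \<le> v" "u + v = 1"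
  have "f (u *\<^sub>R x + v *\<^sub>R y) \<le> u * f x + v * f y"
    using assms xy uv unfolding convex_on_def by blast
  also have "\<dots> \<le> a"
    using xy uv by (intro convex_bound_le) auto
  finally show "u *\<^sub>R x + v *\<^sub>R y \<in> {x \<in> S. f x \<le> a}"
    using convexD[OF convex_on_imp_convex[OF assms]] xy uv by auto
qed

lemma convex_on_exp_sum_eta:
  fixes Tx :: "real ^ ('k::{finite,linorder} option \<times> 'n::finite) ^ 'r"
    and Tu :: "real ^ ('k \<times> 'm::finite) ^ 'r"
  shows "convex_on UNIV (\<lambda>p. exp_sum t (eta Tx Tu y (fst p) (snd p)))"
proof (intro convex_onI convex_UNIV)
  fix s :: real and p q :: "(real ^ ('k option \<times> 'n)) \<times> (real ^ ('k \<times> 'm))"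
  assume s: "0 < s" "s < 1"
  let ?e = "\<lambda>p. eta Tx Tu y (fst p) (snd p)"
  have "y = (1 - s) *\<^sub>R y + s *\<^sub>R y"
    by (simp add: scaleR_left_distrib[symmetric])
  then have comb: "?e ((1 - s) *\<^sub>R p + s *\<^sub>R q) = (1 - s) *\<^sub>R ?e p + s *\<^sub>R ?e q"
    unfolding eta_def
    by (simp add: matrix_vector_right_distrib matrix_vector_mult_scaleR algebra_simps)
  have "exp (t $ i * ?e ((1 - s) *\<^sub>R p + s *\<^sub>R q) $ i) =
      exp ((1 - s) *\<^sub>R (t $ i * ?e p $ i) + s *\<^sub>R (t $ i * ?e q $ i))" for i
    unfolding comb by (simp add: algebra_simps)
  also have "\<dots> i \<le> (1 - s) * exp (t $ i * ?e p $ i) + s * exp (t $ i * ?e q $ i)" for i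
    using s by (intro convex_onD[OF exp_convex]) auto
  finally show "exp_sum t (?e ((1 - s) *\<^sub>R p + s *\<^sub>R q)) \<le>
      (1 - s) * exp_sum t (?e p) + s * exp_sum t (?e q)"
    unfolding exp_sum_def sum_distrib_left sum.distrib[symmetric] by (intro sum_mono) auto
qed

section \<open>The exponential bound on the chance constraint\<close>

text \<open>
  The \<open>i\<close>-th summand is, up to the factor \<open>exp (t\<^sub>i h\<^sub>i)\<close>, the exponential moment of \<open>X\<close> in the
  direction \<open>t\<^sub>i P\<^sub>i\<close>, where \<open>P\<^sub>i\<close> is the \<open>i\<close>-th row of \<open>P\<close>; the symmetric root \<open>R\<close> turns the
  quadratic form of \<open>S\<close> into a squared norm.
\<close>

lemma (in prob_space) expectation_exp_sum_affine:
  fixes X :: "'a \<Rightarrow> real ^ 'd" and P :: "real ^ 'd ^ 'r"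
  assumes "positive_definite S" and "mvn_distributed M X 0 S"
    and "transpose R = R" and "R ** R = S"
  shows "integrable M (\<lambda>\<omega>. exp_sum t (h + P *v X \<omega>))"
    and "expectation (\<lambda>\<omega>. exp_sum t (h + P *v X \<omega>)) =
      (\<Sum>i\<in>UNIV. exp (t $ i * h $ i + (t $ i)\<^sup>2 / 2 * (norm (R *v row i P))\<^sup>2))"
proof -
  have norm: "p \<bullet> (S *v p) = (norm (R *v p))\<^sup>2" for p
    using assms(3) unfolding assms(4)[symmetric] power2_norm_eq_inner
    by (metis dot_lmul_matrix matrix_vector_mul_assoc vector_transpose_matrix)
  have split: "exp (t $ i * (h + P *v X \<omega>) $ i) =
      exp (t $ i * h $ i) * exp ((t $ i *\<^sub>R row i P) \<bullet> X \<omega>)" for i \<omega>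
    by (simp add: exp_add[symmetric] matrix_vector_mul_component row_def vec_nth_inverse distrib_left)
  note moment = expectation_exp_mvn[OF assms(1,2)]
  have int: "integrable M (\<lambda>\<omega>. exp (t $ i * h $ i) * exp ((t $ i *\<^sub>R row i P) \<bullet> X \<omega>))" for i
    by (intro integrable_mult_right moment)
  show "integrable M (\<lambda>\<omega>. exp_sum t (h + P *v X \<omega>))"
    unfolding exp_sum_def split by (intro Bochner_Integration.integrable_sum int)
  have "expectation (\<lambda>\<omega>. exp_sum t (h + P *v X \<omega>)) =
      (\<Sum>i\<in>UNIV. exp (t $ i * h $ i) * expectation (\<lambda>\<omega>. exp ((t $ i *\<^sub>R row i P) \<bullet> X \<omega>)))"
    unfolding exp_sum_def split
    by (simp only: Bochner_Integration.integral_sum[OF int] integral_mult_right_zero)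
  also have "\<dots> = (\<Sum>i\<in>UNIV. exp (t $ i * h $ i + (t $ i)\<^sup>2 / 2 * (norm (R *v row i P))\<^sup>2))"
    unfolding moment
    by (simp add: exp_add[symmetric] matrix_vector_mult_scaleR norm power2_eq_square mult.assoc)
  finally show "expectation (\<lambda>\<omega>. exp_sum t (h + P *v X \<omega>)) =
      (\<Sum>i\<in>UNIV. exp (t $ i * h $ i + (t $ i)\<^sup>2 / 2 * (norm (R *v row i P))\<^sup>2))" .
qed

lemma exp_sum_ge_1:
  assumes "\<And>i. 0 < t $ i" and "\<not> \<eta> \<le> 0"
  shows "1 \<le> exp_sum t \<eta>"
proof -
  obtain i where i: "0 < \<eta> $ i"
    using assms(2) by (auto simp: less_eq_vec_def not_le)
  have "1 \<le> exp (t $ i * \<eta> $ i)"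
    using assms(1)[of i] i by simp
  also have "\<dots> \<le> exp_sum t \<eta>"
    unfolding exp_sum_def by (rule member_le_sum) auto
  finally show ?thesis .
qed

text \<open>Markov's inequality for the sum of exponentials, applied to the event of violation.\<close>

lemma (in prob_space) prob_nonpos_ge_exp_sum:
  fixes Y :: "'a \<Rightarrow> real ^ 'r"
  assumes t: "\<And>i. 0 < t $ i" and Y [measurable]: "Y \<in> borel_measurable M"
    and int: "integrable M (\<lambda>\<omega>. exp_sum t (Y \<omega>))"
  shows "\<P>(\<omega> in M. Y \<omega> \<le> 0) \<ge> 1 - expectation (\<lambda>\<omega>. exp_sum t (Y \<omega>))"
proof -
  let ?E = "{\<omega> \<in> space M. Y \<omega> \<le> 0}"
  have E: "?E \<in> events"
    unfolding less_eq_vec_def by measurable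
  have "1 - prob ?E = prob (space M - ?E)"
    using E by (simp add: prob_compl)
  also have "\<dots> = expectation (indicator (space M - ?E))"
    by (simp add: Int_absorb2)
  also have "\<dots> \<le> expectation (\<lambda>\<omega>. exp_sum t (Y \<omega>))"
  proof (rule integral_mono[OF _ int])
    show "integrable M (indicator (space M - ?E) :: 'a \<Rightarrow> real)"
      using E by (intro integrable_real_indicator) (auto simp: emeasure_eq_measure)
    show "indicator (space M - ?E) \<omega> \<le> exp_sum t (Y \<omega>)" for \<omega>
      using exp_sum_ge_1[OF t, of "Y \<omega>"]
      by (auto simp: indicator_def exp_sum_def intro: sum_nonneg)
  qed
  finally show ?thesis by simp
qed

section \<open>Convex conservative approximation of the chance-constrained problem\<close>

theorem proposition10:
  fixes M :: "'a measure"
    and A :: "real ^ 'n ^ 'n"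
    and B :: "real ^ 'm ^ 'n"
    and x0 :: "real ^ 'n"
    and w :: "nat \<Rightarrow> 'a \<Rightarrow> real ^ 'n"
    and wbar :: "'a \<Rightarrow> real ^ ('k::{finite,linorder} \<times> 'n)"
    and Sig Sroot :: "real ^ ('k \<times> 'n) ^ ('k \<times> 'n)"
    and Tx :: "real ^ ('k option \<times> 'n) ^ 'r"
    and Tu :: "real ^ ('k \<times> 'm) ^ 'r"
    and y :: "real ^ 'r"
  assumes "prob_space M"
    and "\<And>t. t < CARD('k) \<Longrightarrow> w t \<in> borel_measurable M"
    and "\<And>\<omega>. wbar \<omega> = stack_inputs (\<lambda>t. w t \<omega>)"
    and "positive_definite Sig"
    and "mvn_distributed M wbar 0 Sig"
    and "transpose Sroot = Sroot" and "Sroot ** Sroot = Sig"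
  shows
    "(\<forall>t :: real ^ 'r. (\<forall>i. 0 < t $ i) \<longrightarrow>
       (\<forall>\<theta> \<in> (Theta :: ('k, 'm, 'n) policy set).
          (\<integral>\<omega>. exp_sum t (eta Tx Tu y (xbar A B x0 \<theta> (wbar \<omega>)) (ubar \<theta> (wbar \<omega>))) \<partial>M) =
          (\<Sum>i\<in>UNIV. exp (t $ i * h_of A B x0 Tx Tu y \<theta> $ i
             + (t $ i)\<^sup>2 / 2 * (norm (Sroot *v row i (P_of A B Tx Tu \<theta>)))\<^sup>2)))) \<and>
     (\<forall>V :: (real ^ ('k option \<times> 'n)) \<times> (real ^ ('k \<times> 'm)) \<Rightarrow> real.
        V \<in> borel_measurable borel \<longrightarrow> convex_on UNIV V \<longrightarrow>
        (\<forall>\<theta> \<in> (Theta :: ('k, 'm, 'n) policy set).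
           integrable M (\<lambda>\<omega>. V (xbar A B x0 \<theta> (wbar \<omega>), ubar \<theta> (wbar \<omega>)))) \<longrightarrow>
        (\<forall>\<alpha> \<in> {0<..<1}. \<forall>t :: real ^ 'r. (\<forall>i. 0 < t $ i) \<longrightarrow>
           convex_conservative_approx
             \<lparr>decision_space = (Theta :: ('k, 'm, 'n) policy set),
              objective = (\<lambda>\<theta>. \<integral>\<omega>. V (xbar A B x0 \<theta> (wbar \<omega>), ubar \<theta> (wbar \<omega>)) \<partial>M),
              constr = (\<lambda>\<theta>.
                (\<Sum>i\<in>UNIV. exp (t $ i * h_of A B x0 Tx Tu y \<theta> $ i
                   + (t $ i)\<^sup>2 / 2 * (norm (Sroot *v row i (P_of A B Tx Tu \<theta>)))\<^sup>2)) \<le> \<alpha>)\<rparr>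
             \<lparr>decision_space = Theta,
              objective = (\<lambda>\<theta>. \<integral>\<omega>. V (xbar A B x0 \<theta> (wbar \<omega>), ubar \<theta> (wbar \<omega>)) \<partial>M),
              constr = (\<lambda>\<theta>.
                \<P>(\<omega> in M. eta Tx Tu y (xbar A B x0 \<theta> (wbar \<omega>)) (ubar \<theta> (wbar \<omega>)) \<le> 0)
                  \<ge> 1 - \<alpha>)\<rparr>))"
proof -
  interpret prob_space M by fact
  note dist = assms(5)
  have wbar [measurable]: "wbar \<in> borel_measurable M"
    using dist distributed_measurable[of M lborel wbar] by (auto simp: mvn_distributed_def)
  let ?z = "\<lambda>\<theta> \<omega>. (xbar A B x0 \<theta> (wbar \<omega>), ubar \<theta> (wbar \<omega>))"
  let ?eta = "\<lambda>\<theta> \<omega>. eta Tx Tu y (xbar A B x0 \<theta> (wbar \<omega>)) (ubar \<theta> (wbar \<omega>))"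
  let ?g = "\<lambda>t \<theta>. \<Sum>i\<in>UNIV. exp (t $ i * h_of A B x0 Tx Tu y \<theta> $ i
             + (t $ i)\<^sup>2 / 2 * (norm (Sroot *v row i (P_of A B Tx Tu \<theta>)))\<^sup>2)"
  have int: "integrable M (\<lambda>\<omega>. exp_sum t (?eta \<theta> \<omega>))"
    and moment: "(\<integral>\<omega>. exp_sum t (?eta \<theta> \<omega>) \<partial>M) = ?g t \<theta>" for t \<theta>
    unfolding eta_closed_loop
    using expectation_exp_sum_affine[OF assms(4) dist assms(6,7)] by auto
  have meas: "?eta \<theta> \<in> borel_measurable M" for \<theta>
    unfolding eta_closed_loop
    by (intro borel_measurable_add borel_measurable_const
        borel_measurable_continuous_on[OF _ wbar] matrix_vector_mult_linear_continuous_on)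
  \<comment> \<open>By \<open>moment\<close> this is the constraint function, whose convexity is inherited from \<open>exp_sum\<close>.\<close>
  have "convex_on Theta (\<lambda>\<theta>. \<integral>\<omega>. exp_sum t (?eta \<theta> \<omega>) \<partial>M)" for t
    using convex_on_closed_loop_cost[OF convex_on_exp_sum_eta[of t Tx Tu y]]
    by (intro convex_on_integral convex_Theta int) auto
  then have "convex_on Theta (?g t)" for t
    unfolding moment .
  then have feasible_convex: "convex {\<theta> \<in> Theta. ?g t \<theta> \<le> \<alpha>}" for t \<alpha>
    by (rule convex_sublevel)
  have safe: "\<P>(\<omega> in M. ?eta \<theta> \<omega> \<le> 0) \<ge> 1 - \<alpha>"
    if "\<forall>i. 0 < t $ i" "?g t \<theta> \<le> \<alpha>" for t \<theta> \<alpha>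
    using prob_nonpos_ge_exp_sum[OF _ meas int, of t \<theta>] that by (simp add: moment)
  have cost_convex: "convex_on Theta (\<lambda>\<theta>. \<integral>\<omega>. V (?z \<theta> \<omega>) \<partial>M)"
    if "convex_on UNIV V" "\<forall>\<theta>\<in>Theta. integrable M (\<lambda>\<omega>. V (?z \<theta> \<omega>))" for V
    using that by (intro convex_on_integral convex_Theta convex_on_closed_loop_cost) auto
  show ?thesis
    using moment feasible_convex safe cost_convex
    unfolding convex_conservative_approx_def feasible_def by auto
qed

end
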